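(* For every $n\ge\nu$, $$k\left(T_{-\varkappa}(c_{-n-\varkappa}^{\,n-\varkappa})\right)\le\frac{\delta_0}{m_K}\,\frac{1+\rho}{1-\rho}\,\|p\|$$ and $$k\left(T_{-\varkappa}(c_{-n-\varkappa}^{\,n-\varkappa})\right)\le\frac{(2n+1)\,\delta_0}{m_1}\,\|p\|.$$
   Context: Let $p(z)$ be a monic complex polynomial of degree $\nu>1$ with $p(0)\ne0$ and with no zeros on the closed annulus $K=\{z\in\mathbb C: r\le|z|\le R\}$, where $0<r<1<R<\infty$. Let $\varkappa$ be the number of zeros of $p$ (with multiplicity) inside the unit circle; assume $0<\varkappa<\nu$. Write $p=p_1p_2$ where $p_1,p_2$ are monic, $\deg p_1=\varkappa$, $\deg p_2=\nu-\varkappa$, all zeros of $p_1$ lie in $\{|z|<r\}$ and all zeros of $p_2$ lie in $\{|z|>R\}$. Put $m_1=\min_{|z|=1}|p(z)|$, $m_K=\min_{z\in K}|p(z)|$, $\rho=\max\{r,1/R\}$. The norm of a polynomial is the sum of the absolute values of its coefficients. The norm of a matrix $A$ is $\|A\|=\max_j\sum_i|A_{ij}|$, and for an invertible matrix $k(A)=\|A\|\,\|A^{-1}\|$ (the matrices in the claim are invertible). $\delta_0$ denotes any real number such that $\|p_1\|\,\|p_2\|\le\delta_0\|p\|$ and $1\le\delta_0\le\delta^{\nu}\sqrt{(\varkappa+1)(\nu-\varkappa+1)}$, where $\delta=e^{2G/\pi}$ and $G$ is Catalan's constant. Let $c_k$, $k\in\mathbb Z$, be the Laurent coefficients of $1/p(z)=\sum_{k\in\mathbb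 Z}c_kz^k$ in $K$. $T_{-\varkappa}(c_{-n-\varkappa}^{\,n-\varkappa})$ is the $(n+1)\times(n+1)$ Toeplitz matrix with $(i,j)$ entry $c_{-\varkappa+i-j}$, $0\le i,j\le n$. *)

theory Defs
  imports
    "HOL-Analysis.Analysis"
    "HOL-Computational_Algebra.Computational_Algebra"
    "Jordan_Normal_Form.Gauss_Jordan_Elimination"
begin

definition catalan_G :: real where
  "catalan_G = (\<Sum>k. (-1) ^ k / (2 * real k + 1)\<^sup>2)"

definition closed_annulus :: "real \<Rightarrow> real \<Rightarrow> complex set" where
  "closed_annulus r R = {z. r \<le> cmod z \<and> cmod z \<le> R}"

definition poly_norm :: "complex poly \<Rightarrow> real" where
  "poly_norm p = (\<Sum>i\<le>degree p. cmod (coeff p i))"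

(* Used only for nonempty compact S, where the infimum is attained and is a minimum. *)
definition min_modulus_on :: "complex poly \<Rightarrow> complex set \<Rightarrow> real" where
  "min_modulus_on p S = (INF z\<in>S. cmod (poly p z))"

definition mat_norm1 :: "complex mat \<Rightarrow> real" where
  "mat_norm1 A = Max ((\<lambda>j. \<Sum>i<dim_row A. cmod (A $$ (i, j))) ` {..<dim_col A})"

(* Meaningful only for invertible A; otherwise "the (mat_inverse A)" is unspecified. *)
definition mat_cond1 :: "complex mat \<Rightarrow> real" where
  "mat_cond1 A = mat_norm1 A * mat_norm1 (the (mat_inverse A))"

(* Convergence over all of the integers is unconditional, hence absolute. When r < R this
   determines c uniquely, so c is the family of Laurent coefficients of f in the annulus. *)
definition laurent_coeffs_on ::
    "(complex \<Rightarrow> complex) \<Rightarrow> complex set \<Rightarrow> (int \<Rightarrow> complex) \<Rightarrow> bool" where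
  "laurent_coeffs_on f S c \<longleftrightarrow>
     (\<forall>z\<in>S. ((\<lambda>k. c k * z powi k) has_sum f z) UNIV)"

(* T_m(c_{m-n}^{m+n}): the diagonals carry c_{m-n}, ..., c_{m+n}, with c_m on the main one. *)
definition toeplitz_mat :: "int \<Rightarrow> nat \<Rightarrow> (int \<Rightarrow> complex) \<Rightarrow> complex mat" where
  "toeplitz_mat m n c = mat (n + 1) (n + 1) (\<lambda>(i, j). c (m + int i - int j))"

end

(* The matrix is the Toeplitz matrix of the symbol z^kappa / p, whose inverse factors as
   (p1 z^(-kappa)) * p2 with p1 z^(-kappa) a polynomial in 1/z and p2 a polynomial in z. Since
   n >= deg p, each column of the inverse matrix sees at most one end of the matrix and is the
   coefficient vector of a product of a piece of one factor with the whole other factor, so its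
   norm is at most ||p1|| ||p2|| <= delta_0 ||p||. The matrix itself is bounded by summing the
   Cauchy estimates for c_k on the circles of radius r and R, respectively 1. *)

theory Submission
  imports Defs "Jordan_Normal_Form.Determinant"
begin

section \<open>Cauchy estimates and uniqueness for Laurent coefficients\<close>

text \<open>A geometric sum whose ratio \<open>q\<close> satisfies q^N = 1; \<open>q = 1\<close>
  would force N to divide \<open>k\<close>, which the size condition excludes.\<close>

lemma sum_root_of_unity_powi_eq_0:
  assumes "k \<noteq> 0" and "\<bar>k\<bar> < int N"
  shows "(\<Sum>j<N. (cis (2 * pi / real N) ^ j) powi k) = 0"
proof -
  define q where "q = cis (2 * pi / real N) powi k"
  have N: "N > 0" using assms by simp
  have "cis (2 * pi / real N) ^ N = 1"
    using N cis_2pi by (subst Complex.DeMoivre) simp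
  then have "q ^ N = 1"
    unfolding q_def by (metis power_int_1_left power_int_mult power_int_of_nat mult.commute)
  moreover have "q \<noteq> 1"
  proof
    assume "q = 1"
    then have "cis (of_int k * (2 * pi / real N)) = 1"
      by (simp add: q_def cis_power_int)
    then have "cos (of_int k * (2 * pi / real N)) = 1"
      by (metis cis.simps(1) one_complex.simps(1))
    then obtain m :: int where "of_int k * (2 * pi / real N) = of_int m * (2 * pi)"
      by (auto simp: cos_one_2pi_int)
    then have "real_of_int k = of_int m * real N"
      using N by (simp add: field_simps)
    then have "real_of_int k = real_of_int (m * int N)" by simp
    then have "k = m * int N" by (simp only: of_int_eq_iff)
    then show False using assms zdvd_imp_le[of "int N" "\<bar>k\<bar>"] by simp
  qed
  moreover have "(cis (2 * pi / real N) ^ j) powi k = q ^ j" for j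
    unfolding q_def by (metis power_int_mult power_int_of_nat mult.commute)
  ultimately show ?thesis
    by (simp add: sum_gp_strict)
qed

text \<open>Averaging over the \<open>N\<close>-th roots of unity isolates the constant coefficient of a Laurent
  polynomial with exponents in \<open>]-N,N[\<close>; truncation costs an arbitrarily small error.\<close>
lemma laurent_const_coeff_bound:
  fixes c :: "int \<Rightarrow> complex"
  assumes hs: "\<And>z. cmod z = 1 \<Longrightarrow> ((\<lambda>k. c k * z powi k) has_sum f z) UNIV"
    and bd: "\<And>z. cmod z = 1 \<Longrightarrow> cmod (f z) \<le> M"
  shows "cmod (c 0) \<le> M"
proof (rule field_le_epsilon)
  fix \<epsilon> :: real assume "\<epsilon> > 0"
  \<comment> \<open>Unconditional convergence at z = 1 is absolute, and |c k z^k| = |c k| on the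
    unit circle, so one finite set \<open>F\<close> controls the tail for all z at once.\<close>
  have "c summable_on UNIV"
    using hs[of 1] by (simp add: has_sum_imp_summable)
  then have "(\<lambda>k. cmod (c k)) summable_on UNIV"
    by (simp add: summable_on_iff_abs_summable_on_complex)
  then obtain S where S: "((\<lambda>k. cmod (c k)) has_sum S) UNIV"
    by (auto simp: summable_on_def)
  obtain F0 where F0: "finite F0" "dist (\<Sum>k\<in>F0. cmod (c k)) S \<le> \<epsilon>"
    using has_sum_finite_approximation[OF S \<open>\<epsilon> > 0\<close>] by blast
  define F where "F = insert 0 F0"
  have F: "finite F" "0 \<in> F" using F0 by (auto simp: F_def)
  have "(\<Sum>k\<in>F0. cmod (c k)) \<le> (\<Sum>k\<in>F. cmod (c k))"
    using F by (intro sum_mono2) (auto simp: F_def)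
  then have SF: "S - (\<Sum>k\<in>F. cmod (c k)) \<le> \<epsilon>"
    using F0(2) by (simp add: dist_real_def)
  have tail: "cmod (f z - (\<Sum>k\<in>F. c k * z powi k)) \<le> \<epsilon>" if z: "cmod z = 1" for z
  proof -
    have 1: "((\<lambda>k. c k * z powi k) has_sum (f z - (\<Sum>k\<in>F. c k * z powi k))) (UNIV - F)"
      using has_sum_Diff[OF hs[OF z] has_sum_finite[OF F(1)]] by simp
    have "((\<lambda>k. cmod (c k)) has_sum (S - (\<Sum>k\<in>F. cmod (c k)))) (UNIV - F)"
      using has_sum_Diff[OF S has_sum_finite[OF F(1)]] by simp
    then have 2: "((\<lambda>k. cmod (c k * z powi k)) has_sum (S - (\<Sum>k\<in>F. cmod (c k)))) (UNIV - F)"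
      by (simp add: norm_mult norm_power_int z)
    show ?thesis
      using norm_has_sum_bound[OF 2 1] SF by simp
  qed
  \<comment> \<open>N exceeds every |k| in \<open>F\<close>, so averaging over the N-th roots of
    unity kills every exponent in \<open>F\<close> except 0, which was inserted into
    \<open>F\<close> on purpose.\<close>
  define N where "N = Suc (nat (\<Sum>k\<in>F. \<bar>k\<bar>))"
  have N: "\<bar>k\<bar> < int N" if "k \<in> F" for k
    using member_le_sum[OF that, of "\<lambda>k. \<bar>k\<bar>"] F(1) by (simp add: N_def)
  define w where "w j = cis (2 * pi / real N) ^ j" for j
  have w: "cmod (w j) = 1" for j by (simp add: w_def norm_power)
  have "(\<Sum>j<N. \<Sum>k\<in>F. c k * w j powi k) = (\<Sum>k\<in>F. \<Sum>j<N. c k * w j powi k)"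
    by (rule sum.swap)
  also have "\<dots> = (\<Sum>k\<in>F. if k = 0 then of_nat N * c 0 else 0)"
  proof (intro sum.cong refl)
    fix k assume k: "k \<in> F"
    show "(\<Sum>j<N. c k * w j powi k) = (if k = 0 then of_nat N * c 0 else 0)"
      using sum_root_of_unity_powi_eq_0[OF _ N[OF k]]
      by (simp add: w_def flip: sum_distrib_left)
  qed
  also have "\<dots> = of_nat N * c 0" using F by simp
  finally have "real N * cmod (c 0) = cmod (\<Sum>j<N. \<Sum>k\<in>F. c k * w j powi k)"
    by (simp add: norm_mult)
  also have "\<dots> \<le> (\<Sum>j<N. M + \<epsilon>)"
  proof (rule sum_norm_le)
    fix j
    show "cmod (\<Sum>k\<in>F. c k * w j powi k) \<le> M + \<epsilon>"
      using tail[OF w[of j]] bd[OF w[of j]] norm_triangle_sub[of "\<Sum>k\<in>F. c k * w j powi k" "f (w j)"]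
      by (simp add: norm_minus_commute)
  qed
  finally have "real N * cmod (c 0) \<le> real N * (M + \<epsilon>)" by simp
  then show "cmod (c 0) \<le> M + \<epsilon>"
    by (simp add: N_def del: of_nat_Suc)
qed

text \<open>A Cauchy estimate without contour integrals: substituting s z for z and multiplying by
  z^(-k) moves coefficient \<open>k\<close>, scaled by s^k, to position 0, where
  \<open>laurent_const_coeff_bound\<close> applies.\<close>

lemma laurent_coeff_bound:
  fixes c :: "int \<Rightarrow> complex"
  assumes "laurent_coeffs_on f S c" and "sphere 0 s \<subseteq> S" and "s > 0"
    and bd: "\<And>z. cmod z = s \<Longrightarrow> cmod (f z) \<le> M"
  shows "cmod (c k) * s powi k \<le> M"
proof -
  define c' where "c' j = c (j + k) * of_real s powi (j + k)" for j
  define f' where "f' z = f (of_real s * z) * z powi (-k)" for z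
  have "cmod (c' 0) \<le> M"
  proof (rule laurent_const_coeff_bound)
    fix z :: complex assume z: "cmod z = 1"
    have "of_real s * z \<in> S"
      using assms z by (intro subsetD[OF assms(2)]) (simp add: norm_mult)
    then have "((\<lambda>j. c j * (of_real s * z) powi j) has_sum f (of_real s * z)) UNIV"
      using assms(1) by (simp add: laurent_coeffs_on_def)
    then have "((\<lambda>j. c (j + k) * (of_real s * z) powi (j + k)) has_sum f (of_real s * z)) UNIV"
      by (subst has_sum_reindex_bij_witness[of _ "\<lambda>j. j - k" "\<lambda>j. j + k" UNIV
              "\<lambda>j. c j * (of_real s * z) powi j"]) auto
    then have "((\<lambda>j. c (j + k) * (of_real s * z) powi (j + k) * z powi (-k)) has_sum f' z) UNIV"
      unfolding f'_def by (rule has_sum_cmult_left)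
    moreover have "c (j + k) * (of_real s * z) powi (j + k) * z powi (-k) = c' j * z powi j" for j
    proof -
      have "z \<noteq> 0" using z by auto
      then have "z powi (j + k) * z powi (-k) = z powi j"
        by (simp flip: power_int_add)
      then show ?thesis
        by (simp add: c'_def power_int_mult_distrib mult.assoc)
    qed
    ultimately show "((\<lambda>j. c' j * z powi j) has_sum f' z) UNIV" by simp
    show "cmod (f' z) \<le> M"
      using bd[of "of_real s * z"] z \<open>s > 0\<close> by (simp add: f'_def norm_mult norm_power_int)
  qed
  then show ?thesis
    using \<open>s > 0\<close> by (simp add: c'_def norm_mult norm_power_int)
qed

text \<open>The difference of two expansions represents 0, so the Cauchy estimate holds with bound
  0.\<close>

lemma laurent_coeffs_on_unique:
  assumes "laurent_coeffs_on f S c" and "laurent_coeffs_on f S d" and "sphere 0 s \<subseteq> S" and "s > 0"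
  shows "c = d"
proof
  fix k
  have "laurent_coeffs_on (\<lambda>_. 0) S (\<lambda>k. c k - d k)"
    unfolding laurent_coeffs_on_def
  proof
    fix z assume "z \<in> S"
    then have "((\<lambda>k. c k * z powi k + - 1 * (d k * z powi k)) has_sum f z + - 1 * f z) UNIV"
      using assms(1,2) by (intro has_sum_add has_sum_cmult_right) (auto simp: laurent_coeffs_on_def)
    then show "((\<lambda>k. (c k - d k) * z powi k) has_sum 0) UNIV"
      by (simp add: left_diff_distrib)
  qed
  then have "cmod (c k - d k) * s powi k \<le> 0"
    using assms(3,4) by (rule laurent_coeff_bound) simp
  then show "c k = d k"
    using \<open>s > 0\<close> by (smt (verit) eq_iff_diff_eq_0 mult_pos_pos zero_less_norm_iff zero_less_power_int)
qed

section \<open>Polynomials acting on two-sided sequences by convolution\<close>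

text \<open>This is \<open>q\<close> evaluated at the shift operator that sends \<open>c\<close> to
  the sequence with k-th term \<open>c (k - 1)\<close>. It is the coefficient side of multiplying a
  Laurent series by \<open>q\<close>.\<close>

definition poly_conv :: "'a::comm_ring_1 poly \<Rightarrow> (int \<Rightarrow> 'a) \<Rightarrow> int \<Rightarrow> 'a" where
  "poly_conv q c k = (\<Sum>i\<le>degree q. coeff q i * c (k - int i))"

lemma poly_conv_altdef:
  assumes "degree q \<le> N"
  shows "poly_conv q c k = (\<Sum>i\<le>N. coeff q i * c (k - int i))"
  unfolding poly_conv_def
  using assms by (intro sum.mono_neutral_left) (auto simp: coeff_eq_0)

lemma poly_conv_0 [simp]: "poly_conv 0 c k = 0"
  by (simp add: poly_conv_def)

lemma poly_conv_1 [simp]: "poly_conv 1 c k = c k"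
  by (simp add: poly_conv_def)

lemma poly_conv_pCons: "poly_conv (pCons a q) c k = a * c k + poly_conv q c (k - 1)"
proof -
  have "poly_conv (pCons a q) c k = (\<Sum>i\<le>Suc (degree q). coeff (pCons a q) i * c (k - int i))"
    by (rule poly_conv_altdef) (simp add: degree_pCons_le)
  also have "\<dots> = a * c k + (\<Sum>i\<le>degree q. coeff q i * c (k - int (Suc i)))"
    by (subst sum.atMost_Suc_shift) simp
  finally show ?thesis by (simp add: poly_conv_def algebra_simps)
qed

lemma poly_conv_add: "poly_conv (p + q) c k = poly_conv p c k + poly_conv q c k"
proof -
  define N where "N = max (degree p) (degree q)"
  have "degree p \<le> N" "degree q \<le> N" "degree (p + q) \<le> N"
    by (auto simp: N_def degree_add_le_max)
  then show ?thesis
    by (simp add: poly_conv_altdef[of _ N] algebra_simps sum.distrib)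
qed

lemma poly_conv_smult: "poly_conv (Polynomial.smult a q) c k = a * poly_conv q c k"
  unfolding poly_conv_altdef[OF degree_smult_le] by (simp add: sum_distrib_left mult.assoc poly_conv_def)

text \<open>The action is multiplicative, so the factors of a polynomial can be applied, and later
  inverted, one at a time.\<close>

lemma poly_conv_mult: "poly_conv (p * q) c k = poly_conv p (poly_conv q c) k"
  by (induction p arbitrary: k)
     (simp_all add: mult_pCons_left poly_conv_add poly_conv_smult poly_conv_pCons)

lemma poly_conv_monom: "poly_conv (monom 1 m) c k = c (k - int m)"
  by (induction m arbitrary: k) (simp_all add: monom_0 monom_Suc poly_conv_pCons algebra_simps)

lemma laurent_coeffs_on_poly_conv:
  assumes "laurent_coeffs_on f S c" and "0 \<notin> S"
  shows "laurent_coeffs_on (\<lambda>z. poly q z * f z) S (poly_conv q c)"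
  unfolding laurent_coeffs_on_def
proof
  fix z assume z: "z \<in> S"
  then have "z \<noteq> 0" using assms(2) by auto
  show "((\<lambda>k. poly_conv q c k * z powi k) has_sum poly q z * f z) UNIV"
  proof (induction q)
    case (pCons a q)
    \<comment> \<open>Multiplication by z is a shift of the index; recombining the powers below
      needs z to be nonzero.\<close>
    have "((\<lambda>k. poly_conv q c (k - 1) * z powi (k - 1)) has_sum poly q z * f z) UNIV"
      using pCons.IH
      by (subst has_sum_reindex_bij_witness[of _ "\<lambda>j. j + 1" "\<lambda>j. j - 1" UNIV
              "\<lambda>k. poly_conv q c k * z powi k"]) auto
    then have "((\<lambda>k. z * (poly_conv q c (k - 1) * z powi (k - 1)))
        has_sum z * (poly q z * f z)) UNIV"
      by (rule has_sum_cmult_right)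
    moreover have "((\<lambda>k. a * (c k * z powi k)) has_sum a * f z) UNIV"
      using assms(1) z by (intro has_sum_cmult_right) (auto simp: laurent_coeffs_on_def)
    ultimately have "((\<lambda>k. a * (c k * z powi k) + z * (poly_conv q c (k - 1) * z powi (k - 1)))
        has_sum (a * f z + z * (poly q z * f z))) UNIV"
      by (intro has_sum_add)
    moreover have "a * (c k * z powi k) + z * (poly_conv q c (k - 1) * z powi (k - 1)) =
        poly_conv (pCons a q) c k * z powi k" for k
      using \<open>z \<noteq> 0\<close> by (simp add: power_int_diff poly_conv_pCons distrib_right)
    ultimately show ?case
      by (simp add: algebra_simps)
  qed simp
qed

lemma laurent_coeffs_on_1: "laurent_coeffs_on (\<lambda>_. 1) S (\<lambda>k. of_bool (k = 0))"
  unfolding laurent_coeffs_on_def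
proof
  fix z :: complex
  show "((\<lambda>k. of_bool (k = 0) * z powi k) has_sum 1) UNIV"
    by (rule has_sum_finite_neutralI[of "{0}"]) auto
qed

lemma poly_conv_bounded:
  fixes b :: "int \<Rightarrow> complex"
  assumes "\<And>k. cmod (b k) \<le> B"
  shows "cmod (poly_conv q b k) \<le> poly_norm q * B"
proof -
  have "cmod (poly_conv q b k) \<le> (\<Sum>i\<le>degree q. cmod (coeff q i) * B)"
    unfolding poly_conv_def
    by (rule sum_norm_le) (simp add: norm_mult mult_left_mono assms)
  then show ?thesis by (simp add: poly_norm_def sum_distrib_right)
qed

section \<open>Bounded solutions of one-sided linear recurrences\<close>

lemma geometric_bound_imp_0:
  assumes "\<And>m::nat. cmod x \<le> q ^ m * B" and "0 \<le> q" and "q < 1"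
  shows "x = 0"
proof -
  have "(\<lambda>m. q ^ m * B) \<longlonglongrightarrow> 0 * B"
    using assms by (intro tendsto_intros LIMSEQ_power_zero) simp
  then have "cmod x \<le> 0 * B"
    using assms(1) by (intro LIMSEQ_le_const) auto
  then show ?thesis by simp
qed

text \<open>A bounded solution of \<open>b (k - 1) = a * b k\<close> along a ray vanishes there if iterating the
  recurrence into the ray is contracting. The general case strips off one zero at a time.\<close>
lemma poly_conv_eq_0_above:
  fixes b :: "int \<Rightarrow> complex"
  assumes "\<And>z. poly q z = 0 \<Longrightarrow> cmod z < 1" and "lead_coeff q = 1"
    and "\<And>k. cmod (b k) \<le> B" and "\<And>k. k > m \<Longrightarrow> poly_conv q b k = 0"
    and "k > m - int (degree q)"
  shows "b k = 0"
  using assms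
proof (induction "degree q" arbitrary: q b B m k)
  case 0
  then have "q = 1" by (metis degree_0_id one_pCons)
  then show ?case using 0 by simp
next
  case (Suc n)
  have "\<not> constant (poly q)" using Suc.hyps(2) by (simp add: constant_degree)
  then obtain a where a: "poly q a = 0" using fundamental_theorem_of_algebra by blast
  then obtain s where s: "q = [:-a, 1:] * s" by (auto simp: poly_eq_0_iff_dvd elim: dvdE)
  then have ls: "lead_coeff s = 1" 
    using Suc.prems(2) lead_coeff_mult[of "[:-a, 1:]" s] by (simp add: s del: mult_pCons_left)
  then have "s \<noteq> 0" by auto
  then have ds: "degree s = n"
    using Suc.hyps(2) degree_mult_eq[of "[:-a, 1:]" s] by (simp add: s del: mult_pCons_left)
  have a1: "cmod a < 1" using Suc.prems(1) a by blast
  define d where "d = poly_conv s b"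
  have d: "d (k - 1) = a * d k" if "k > m" for k
    using Suc.prems(4)[OF that] by (simp only: s poly_conv_mult) (simp add: poly_conv_pCons d_def)
  have "d (m + int j) = 0" for j
  proof (rule geometric_bound_imp_0)
    fix i
    have "d (m + int j) = a ^ i * d (m + int j + int i)"
    proof (induction i)
      case (Suc i)
      have "d (m + int j + int i) = a * d (m + int j + int (Suc i))"
        using d[of "m + int j + int (Suc i)"] by (simp add: algebra_simps)
      then show ?case using Suc by simp
    qed simp
    then have "cmod (d (m + int j)) = cmod a ^ i * cmod (d (m + int j + int i))"
      by (simp add: norm_mult norm_power)
    also have "\<dots> \<le> cmod a ^ i * (poly_norm s * B)"
      unfolding d_def by (intro mult_left_mono poly_conv_bounded Suc.prems) simp
    finally show "cmod (d (m + int j)) \<le> cmod a ^ i * (poly_norm s * B)" .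
  qed (use a1 in auto)
  \<comment> \<open>The recurrence at m + 1 already reaches \<open>d m\<close>, so each zero removed
    lowers the threshold by one. This is where \<open>degree q\<close> in the conclusion comes
    from.\<close>
  then have "poly_conv s b k = 0" if "k > m - 1" for k
    using that zle_iff_zadd[of m k] by (auto simp: d_def)
  then show ?case
    using Suc.prems(1,3,5) ds Suc.hyps(2) ls s
    by (intro Suc.hyps(1)[of s b B "m - 1" k]) auto
qed

text \<open>Mirror image of \<open>poly_conv_eq_0_above\<close>: for a zero of modulus above 1, its
  inverse contracts downwards. No index is gained, since \<open>d k\<close> itself is expressed
  through \<open>d (k - 1)\<close>, so \<open>m\<close> stays fixed in the induction.\<close>

lemma poly_conv_eq_0_below:
  fixes b :: "int \<Rightarrow> complex"
  assumes "\<And>z. poly q z = 0 \<Longrightarrow> cmod z > 1" and "q \<noteq> 0"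
    and "\<And>k. cmod (b k) \<le> B" and "\<And>k. k < m \<Longrightarrow> poly_conv q b k = 0"
    and "k < m"
  shows "b k = 0"
  using assms
proof (induction "degree q" arbitrary: q b B k)
  case 0
  then obtain u where "q = [:u:]" "u \<noteq> 0" by (metis degree_0_id pCons_0_0)
  then show ?case using "0.prems"(4)[of k] "0.prems"(5) by (simp add: poly_conv_pCons)
next
  case (Suc n)
  have "\<not> constant (poly q)" using Suc.hyps(2) by (simp add: constant_degree)
  then obtain a where a: "poly q a = 0" using fundamental_theorem_of_algebra by blast
  then obtain s where s: "q = [:-a, 1:] * s" by (auto simp: poly_eq_0_iff_dvd elim: dvdE)
  then have "s \<noteq> 0" using Suc.prems(2) by auto
  then have ds: "degree s = n"
    using Suc.hyps(2) degree_mult_eq[of "[:-a, 1:]" s] by (simp add: s del: mult_pCons_left)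
  have a1: "cmod a > 1" using Suc.prems(1) a by blast
  define d where "d = poly_conv s b"
  have d: "d k = inverse a * d (k - 1)" if "k < m" for k
    using Suc.prems(4)[OF that] a1
    by (simp only: s poly_conv_mult) (auto simp add: poly_conv_pCons d_def field_simps)
  have "d k = 0" if "k < m" for k
  proof (rule geometric_bound_imp_0)
    fix i
    have "d k = inverse a ^ i * d (k - int i)"
    proof (induction i)
      case (Suc i)
      have "d (k - int i) = inverse a * d (k - int (Suc i))"
        using d[of "k - int i"] that by (simp add: algebra_simps)
      then show ?case using Suc by simp
    qed simp
    then have "cmod (d k) = inverse (cmod a) ^ i * cmod (d (k - int i))"
      by (metis norm_mult norm_power norm_inverse)
    also have "\<dots> \<le> inverse (cmod a) ^ i * (poly_norm s * B)"
      unfolding d_def by (intro mult_left_mono poly_conv_bounded Suc.prems) simp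
    finally show "cmod (d k) \<le> inverse (cmod a) ^ i * (poly_norm s * B)" .
  qed (use a1 in \<open>auto simp: inverse_less_1_iff\<close>)
  then show ?case
    using Suc.prems(1,3,5) ds \<open>s \<noteq> 0\<close> s
    by (intro Suc.hyps(1)[of s b B k]) (auto simp: d_def)
qed

section \<open>The coefficient norm under products, cutoffs and shifts\<close>

lemma poly_norm_altdef:
  assumes "degree q \<le> N"
  shows "poly_norm q = (\<Sum>i\<le>N. cmod (coeff q i))"
  unfolding poly_norm_def
  using assms by (intro sum.mono_neutral_left) (auto simp: coeff_eq_0)

lemma poly_norm_nonneg: "0 \<le> poly_norm q"
  by (simp add: poly_norm_def sum_nonneg)

lemma poly_norm_pCons: "poly_norm (pCons a q) = cmod a + poly_norm q"
proof -
  have "poly_norm (pCons a q) = (\<Sum>i\<le>Suc (degree q). cmod (coeff (pCons a q) i))"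
    by (rule poly_norm_altdef) (simp add: degree_pCons_le)
  also have "\<dots> = cmod a + (\<Sum>i\<le>degree q. cmod (coeff q i))"
    by (subst sum.atMost_Suc_shift) simp
  finally show ?thesis by (simp add: poly_norm_def)
qed

lemma poly_norm_add: "poly_norm (p + q) \<le> poly_norm p + poly_norm q"
proof -
  define N where "N = max (degree p) (degree q)"
  have "degree p \<le> N" "degree q \<le> N" "degree (p + q) \<le> N"
    by (auto simp: N_def degree_add_le_max)
  then show ?thesis
    by (simp add: poly_norm_altdef[of _ N] norm_triangle_ineq sum_mono flip: sum.distrib)
qed

lemma poly_norm_smult: "poly_norm (Polynomial.smult a q) = cmod a * poly_norm q"
  unfolding poly_norm_altdef[OF degree_smult_le] by (simp add: sum_distrib_left norm_mult poly_norm_def)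

lemma poly_norm_mult: "poly_norm (p * q) \<le> poly_norm p * poly_norm q"
proof (induction p)
  case 0
  then show ?case by (simp add: poly_norm_def)
next
  case (pCons a p)
  then show ?case
    using poly_norm_add[of "Polynomial.smult a q" "pCons 0 (p * q)"]
    by (simp add: mult_pCons_left poly_norm_smult poly_norm_pCons algebra_simps)
qed

lemma poly_norm_monom_mult: "poly_norm (monom 1 m * q) = poly_norm q"
  by (induction m) (simp_all add: monom_0 monom_Suc poly_norm_pCons)

lemma degree_poly_cutoff_le: "degree (poly_cutoff n q) \<le> n - 1"
  by (rule degree_le) (auto simp: coeff_poly_cutoff)

lemma degree_poly_shift_le: "degree (poly_shift n q) \<le> degree q - n"
  by (rule degree_le) (auto simp: coeff_poly_shift coeff_eq_0)

lemma poly_cutoff_plus_shift: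
  fixes q :: "'a::comm_semiring_1 poly"
  shows "q = poly_cutoff n q + monom 1 n * poly_shift n q"
  by (rule poly_eqI) (simp add: coeff_poly_cutoff coeff_monom_mult coeff_poly_shift)

text \<open>The two pieces share no coefficient, so there is no loss as in the triangle inequality.
  Hence either piece of a factor is bounded by the norm of the whole factor.\<close>

lemma poly_norm_cutoff_plus_shift:
  "poly_norm q = poly_norm (poly_cutoff n q) + poly_norm (poly_shift n q)"
proof (induction n arbitrary: q)
  case 0
  have "poly_cutoff 0 q = 0" by (simp add: poly_eq_iff coeff_poly_cutoff)
  then show ?case by (simp add: poly_norm_def)
next
  case (Suc n)
  obtain a q' where q: "q = pCons a q'" by (cases q)
  have "poly_cutoff (Suc n) q = pCons a (poly_cutoff n q')"
    by (rule poly_eqI) (auto simp: q coeff_poly_cutoff coeff_pCons split: nat.splits)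
  moreover have "poly_shift (Suc n) q = poly_shift n q'"
    by (rule poly_eqI) (auto simp: q coeff_poly_shift)
  ultimately show ?case using Suc[of q'] by (simp add: q poly_norm_pCons)
qed

section \<open>Column-sum norm, matrix inverse and a two-sided geometric sum\<close>

lemma mat_norm1_le:
  assumes "A \<in> carrier_mat n m" and "m > 0"
    and "\<And>j. j < m \<Longrightarrow> (\<Sum>i<n. cmod (A $$ (i, j))) \<le> B"
  shows "mat_norm1 A \<le> B"
  unfolding mat_norm1_def using assms by (intro Max.boundedI) auto

lemma mat_norm1_nonneg:
  assumes "A \<in> carrier_mat n m" and "m > 0"
  shows "0 \<le> mat_norm1 A"
proof -
  have "(\<Sum>i<n. cmod (A $$ (i, 0))) \<le> mat_norm1 A"
    unfolding mat_norm1_def using assms by (intro Max_ge) auto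
  moreover have "0 \<le> (\<Sum>i<n. cmod (A $$ (i, 0)))" by (simp add: sum_nonneg)
  ultimately show ?thesis by linarith
qed

text \<open>Over a field a right inverse of a square matrix is two-sided and unique. Thus any
  exhibited right inverse is the matrix hidden behind \<open>the\<close> in
  \<open>mat_cond1\<close>.\<close>

lemma mat_inverse_eq_Some:
  fixes A X :: "'a::field mat"
  assumes A: "A \<in> carrier_mat n n" and X: "X \<in> carrier_mat n n" and AX: "A * X = 1\<^sub>m n"
  shows "mat_inverse A = Some X"
proof (cases "mat_inverse A")
  case None
  have "X * A = 1\<^sub>m n" using mat_mult_left_right_inverse[OF A X AX] .
  then have "A \<in> Units (ring_mat TYPE('a) n ())"
    unfolding Units_def using A X AX by (auto simp: ring_mat_def)
  then show ?thesis using mat_inverse(1)[OF A None, where b = "()"] by blast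
next
  case (Some B)
  then have B: "B * A = 1\<^sub>m n" "B \<in> carrier_mat n n" using mat_inverse(2)[OF A] by auto
  have "B = B * (A * X)" using B AX by simp
  also have "\<dots> = (B * A) * X" using assoc_mult_mat[OF B(2) A X] by simp
  also have "\<dots> = X" using B X by simp
  finally show ?thesis using Some by simp
qed

lemma mat_cond1_eq:
  assumes A: "A \<in> carrier_mat n n" and X: "X \<in> carrier_mat n n" and AX: "A * X = 1\<^sub>m n"
  shows "invertible_mat A" and "mat_cond1 A = mat_norm1 A * mat_norm1 X"
proof -
  show "invertible_mat A"
    unfolding invertible_mat_def inverts_mat_def
    using A X AX mat_mult_left_right_inverse[OF A X AX] by auto
  show "mat_cond1 A = mat_norm1 A * mat_norm1 X"
    using mat_inverse_eq_Some[OF assms] by (simp add: mat_cond1_def)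
qed

text \<open>The right-hand side is the sum of the series over all integers. \<open>F\<close> is
  enclosed in a symmetric interval, whose sum has a closed form lying below that value.\<close>

lemma sum_power_abs_le:
  fixes \<rho> :: real
  assumes "finite F" and "0 \<le> \<rho>" and "\<rho> < 1"
  shows "(\<Sum>k\<in>F. \<rho> ^ nat \<bar>k\<bar>) \<le> (1 + \<rho>) / (1 - \<rho>)"
proof -
  have eq: "(\<Sum>k\<in>{- int N..int N}. \<rho> ^ nat \<bar>k\<bar>) = (1 + \<rho> - 2 * \<rho> ^ Suc N) / (1 - \<rho>)" for N
  proof (induction N)
    case 0
    then show ?case using assms by simp
  next
    case (Suc N)
    have "{- int (Suc N)..int (Suc N)} = insert (- int (Suc N)) (insert (int (Suc N)) {- int N..int N})"
      by auto
    then have "(\<Sum>k\<in>{- int (Suc N)..int (Suc N)}. \<rho> ^ nat \<bar>k\<bar>) =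
        2 * \<rho> ^ Suc N + (\<Sum>k\<in>{- int N..int N}. \<rho> ^ nat \<bar>k\<bar>)"
      by (simp del: of_nat_Suc)
    then show ?case unfolding Suc using assms by (simp add: field_simps)
  qed
  define N where "N = nat (\<Sum>k\<in>F. \<bar>k\<bar>)"
  have "\<bar>k\<bar> \<le> int N" if "k \<in> F" for k
    using member_le_sum[OF that, of "\<lambda>k. \<bar>k\<bar>"] assms by (simp add: N_def)
  then have "F \<subseteq> {- int N..int N}" by (force simp: abs_le_iff)
  then have "(\<Sum>k\<in>F. \<rho> ^ nat \<bar>k\<bar>) \<le> (\<Sum>k\<in>{- int N..int N}. \<rho> ^ nat \<bar>k\<bar>)"
    using assms by (intro sum_mono2) auto
  also have "\<dots> \<le> (1 + \<rho>) / (1 - \<rho>)"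
    unfolding eq using assms by (intro divide_right_mono) auto
  finally show ?thesis .
qed

section \<open>Explicit inverse of the Toeplitz matrix\<close>

text \<open>Column \<open>j\<close> of the inverse is obtained from the factorization \<open>p\<^sub>1 z\<^sup>-\<^sup>\<kappa> \<cdot> p\<^sub>2\<close> of the
  inverse symbol: its coefficient generating polynomial is \<open>[p\<^sub>1 z\<^sup>j\<^sup>-\<^sup>\<kappa>]\<^sub>+ p\<^sub>2\<close> if \<open>j < \<kappa>\<close>, and
  \<open>p\<^sub>1 z\<^sup>-\<^sup>\<kappa>\<close> times the part of \<open>z\<^sup>j p\<^sub>2\<close> of degree at most \<open>n\<close> otherwise. The discarded terms
  only affect rows outside of \<open>0..n\<close>.\<close>
lemma toeplitz_mat_right_inverse:
  fixes p1 p2 :: "complex poly"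
  assumes conv: "\<And>k. poly_conv (p1 * p2) c k = of_bool (k = 0)"
    and c: "\<And>k. cmod (c k) \<le> B"
    and p1: "degree p1 = \<kappa>" "lead_coeff p1 = 1" "\<And>z. poly p1 z = 0 \<Longrightarrow> cmod z < 1"
    and p2: "p2 \<noteq> 0" "\<And>z. poly p2 z = 0 \<Longrightarrow> cmod z > 1"
    and n: "degree p1 + degree p2 \<le> n"
  obtains X where "X \<in> carrier_mat (n + 1) (n + 1)"
    and "toeplitz_mat (- int \<kappa>) n c * X = 1\<^sub>m (n + 1)"
    and "mat_norm1 X \<le> poly_norm p1 * poly_norm p2"
proof -
  \<comment> \<open>With \<open>c\<close> standing for 1 / (p1 p2), \<open>d\<close> and
    \<open>e\<close> stand for the Laurent coefficients of 1 / p1 and 1 / p2. The zeros of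
    \<open>p1\<close> lie inside and those of \<open>p2\<close> outside the unit circle, so
    boundedness confines \<open>d\<close> to exponents at most -\<kappa> and \<open>e\<close> to
    exponents at least 0.\<close>
  define d where "d = poly_conv p2 c"
  define e where "e = poly_conv p1 c"
  have p1d: "poly_conv p1 d k = of_bool (k = 0)" for k
    unfolding d_def by (simp only: conv flip: poly_conv_mult)
  have p2e: "poly_conv p2 e k = of_bool (k = 0)" for k
    unfolding e_def by (simp only: conv mult.commute[of p2 p1] flip: poly_conv_mult)
  have d0: "d k = 0" if "k > - int \<kappa>" for k
  proof (rule poly_conv_eq_0_above[where q = p1 and m = 0])
    show "cmod (d k) \<le> poly_norm p2 * B" for k unfolding d_def by (intro poly_conv_bounded c)
  qed (use p1 that in \<open>auto simp: p1d\<close>)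
  have e0: "e k = 0" if "k < 0" for k
  proof (rule poly_conv_eq_0_below[where q = p2 and m = 0])
    show "cmod (e k) \<le> poly_norm p1 * B" for k unfolding e_def by (intro poly_conv_bounded c)
  qed (use p2 that in \<open>auto simp: p2e\<close>)
  define x where "x j = (if j < \<kappa> then poly_shift (\<kappa> - j) p1 * p2
      else monom 1 (j - \<kappa>) * (p1 * poly_cutoff (n + 1 - j) p2))" for j
  \<comment> \<open>Rows 0 to \<open>n\<close> must hold every coefficient of \<open>x j\<close>.
    The condition on \<open>n\<close> enters for \<open>j < \<kappa>\<close>; otherwise the cutoff
    gives (j - \<kappa>) + \<kappa> + (n - j) = n.\<close>
  have deg: "degree (x j) \<le> n" if "j \<le> n" for j
  proof (cases "j < \<kappa>")
    case True
    have "degree (x j) \<le> degree (poly_shift (\<kappa> - j) p1) + degree p2"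
      using True by (simp add: x_def degree_mult_le)
    also have "\<dots> \<le> n" using degree_poly_shift_le[of "\<kappa> - j" p1] n p1(1) by linarith
    finally show ?thesis .
  next
    case False
    have "degree (x j) \<le> degree (monom 1 (j - \<kappa>) :: complex poly)
        + (degree p1 + degree (poly_cutoff (n + 1 - j) p2))"
      using False unfolding x_def
      by (auto intro!: order.trans[OF degree_mult_le] add_left_mono degree_mult_le)
    also have "\<dots> \<le> n"
      using degree_poly_cutoff_le[of "n + 1 - j" p2] degree_monom_le[of "1::complex" "j - \<kappa>"]
        p1(1) False that by linarith
    finally show ?thesis .
  qed
  have norm: "poly_norm (x j) \<le> poly_norm p1 * poly_norm p2" for j
  proof (cases "j < \<kappa>")
    case True
    have "poly_norm (x j) \<le> poly_norm (poly_shift (\<kappa> - j) p1) * poly_norm p2"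
      using True by (simp add: x_def poly_norm_mult)
    also have "\<dots> \<le> poly_norm p1 * poly_norm p2"
      using poly_norm_cutoff_plus_shift[of p1 "\<kappa> - j"] poly_norm_nonneg
      by (intro mult_right_mono) auto
    finally show ?thesis .
  next
    case False
    have "poly_norm (x j) \<le> poly_norm p1 * poly_norm (poly_cutoff (n + 1 - j) p2)"
      using False by (simp add: x_def poly_norm_monom_mult poly_norm_mult)
    also have "\<dots> \<le> poly_norm p1 * poly_norm p2"
      using poly_norm_cutoff_plus_shift[of p2 "n + 1 - j"] poly_norm_nonneg
      by (intro mult_left_mono) auto
    finally show ?thesis .
  qed
  \<comment> \<open>Row \<open>i\<close> of the Toeplitz matrix applied to the coefficients of
    \<open>x j\<close> is this convolution, so the claim is exactly entry (i, j) of the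
    identity.\<close>
  have conv_x: "poly_conv (x j) c (int i - int \<kappa>) = of_bool (i = j)" if "i \<le> n" "j \<le> n" for i j
  proof (cases "j < \<kappa>")
    case True
    define l where "l = \<kappa> - j"
    \<comment> \<open>The discarded coefficients have m < \<kappa> - j, so the index i - j - m
      exceeds i - \<kappa>, hence also -\<kappa>, where \<open>d\<close> vanishes.\<close>
    have "coeff (poly_cutoff l p1) m * d (int i - int j - int m) = 0" for m
      using True by (simp add: coeff_poly_cutoff d0 l_def)
    then have low: "poly_conv (poly_cutoff l p1) d (int i - int j) = 0"
      unfolding poly_conv_def by (intro sum.neutral) simp
    have "of_bool (i = j) = poly_conv p1 d (int i - int j)"
      by (simp add: p1d)
    also have "\<dots> = poly_conv (poly_cutoff l p1 + monom 1 l * poly_shift l p1) d (int i - int j)"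
      by (simp flip: poly_cutoff_plus_shift)
    also have "\<dots> = poly_conv (poly_shift l p1) d (int i - int \<kappa>)"
      using True by (simp add: poly_conv_add poly_conv_mult poly_conv_monom low) (simp add: l_def)
    also have "\<dots> = poly_conv (x j) c (int i - int \<kappa>)"
      using True by (simp add: x_def d_def poly_conv_mult l_def)
    finally show ?thesis by simp
  next
    case False
    define l where "l = n + 1 - j"
    \<comment> \<open>The discarded part only meets \<open>e\<close> at indices up to i - j - l = i
      - n - 1, which is negative for every row.\<close>
    have "poly_conv (poly_shift l p2) e (int i - int j - int l) = 0"
      using that by (simp add: poly_conv_def e0 l_def)
    then have "poly_conv (poly_cutoff l p2) e (int i - int j) =
        poly_conv (poly_cutoff l p2 + monom 1 l * poly_shift l p2) e (int i - int j)"
      by (simp add: poly_conv_add poly_conv_mult poly_conv_monom)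
    also have "\<dots> = of_bool (i = j)"
      by (simp add: p2e flip: poly_cutoff_plus_shift)
    finally have "poly_conv (poly_cutoff l p2) e (int i - int j) = of_bool (i = j)" .
    moreover have "x j = monom 1 (j - \<kappa>) * (poly_cutoff l p2 * p1)"
      using False by (simp add: x_def l_def mult.commute)
    ultimately show ?thesis
      using False by (simp add: poly_conv_mult poly_conv_monom e_def)
  qed
  define X where "X = mat (n + 1) (n + 1) (\<lambda>(i, j). coeff (x j) i)"
  have X: "X \<in> carrier_mat (n + 1) (n + 1)" by (simp add: X_def)
  have "toeplitz_mat (- int \<kappa>) n c * X = 1\<^sub>m (n + 1)"
  proof (rule eq_matI)
    fix i j assume "i < dim_row (1\<^sub>m (n + 1))" "j < dim_col (1\<^sub>m (n + 1))"
    then have ij: "i \<le> n" "j \<le> n" by auto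
    have "(toeplitz_mat (- int \<kappa>) n c * X) $$ (i, j) =
        (\<Sum>l\<le>n. coeff (x j) l * c (int i - int \<kappa> - int l))"
      using ij by (simp add: X_def toeplitz_mat_def scalar_prod_def
          atLeast0LessThan lessThan_Suc_atMost mult.commute algebra_simps del: sum.lessThan_Suc)
    also have "\<dots> = of_bool (i = j)"
      using conv_x[OF ij] poly_conv_altdef[OF deg[OF ij(2)]] by simp
    finally show "(toeplitz_mat (- int \<kappa>) n c * X) $$ (i, j) = 1\<^sub>m (n + 1) $$ (i, j)"
      using ij by simp
  qed (simp_all add: X_def toeplitz_mat_def)
  moreover have "mat_norm1 X \<le> poly_norm p1 * poly_norm p2"
  proof (rule mat_norm1_le[OF X])
    fix j assume j: "j < n + 1"
    then have "(\<Sum>i<n + 1. cmod (X $$ (i, j))) = (\<Sum>i<n + 1. cmod (coeff (x j) i))"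
      by (intro sum.cong) (auto simp: X_def)
    also have "\<dots> = poly_norm (x j)"
      using poly_norm_altdef[OF deg[of j]] j by (simp add: lessThan_Suc_atMost del: sum.lessThan_Suc)
    finally show "(\<Sum>i<n + 1. cmod (X $$ (i, j))) \<le> poly_norm p1 * poly_norm p2"
      using norm[of j] by simp
  qed simp
  ultimately show ?thesis using that X by blast
qed

section \<open>Norm of the Toeplitz matrix and the two condition number estimates\<close>

lemma toeplitz_mat_carrier: "toeplitz_mat m n c \<in> carrier_mat (n + 1) (n + 1)"
  by (simp add: toeplitz_mat_def)

text \<open>Each column lists \<open>c\<close> at n + 1 distinct indices, so a bound uniform over
  such index sets serves all columns at once.\<close>

lemma toeplitz_mat_norm_le:
  assumes "\<And>F. finite F \<Longrightarrow> card F = n + 1 \<Longrightarrow> (\<Sum>k\<in>F. cmod (c k)) \<le> B"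
  shows "mat_norm1 (toeplitz_mat m n c) \<le> B"
proof (rule mat_norm1_le[OF toeplitz_mat_carrier])
  fix j assume j: "j < n + 1"
  define g where "g i = m + int i - int j" for i
  have g: "inj_on g {..<n + 1}" by (auto simp: g_def inj_on_def)
  have "(\<Sum>i<n + 1. cmod (toeplitz_mat m n c $$ (i, j))) = (\<Sum>i<n + 1. cmod (c (g i)))"
    using j by (intro sum.cong) (auto simp: toeplitz_mat_def g_def)
  also have "\<dots> = (\<Sum>k\<in>g ` {..<n + 1}. cmod (c k))"
    using g by (simp add: sum.reindex del: sum.lessThan_Suc)
  also have "\<dots> \<le> B"
    using g by (intro assms) (auto simp: card_image)
  finally show "(\<Sum>i<n + 1. cmod (toeplitz_mat m n c $$ (i, j))) \<le> B" .
qed simp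

lemma min_modulus_on_pos:
  assumes "compact S" and "S \<noteq> {}" and "\<And>z. z \<in> S \<Longrightarrow> poly p z \<noteq> 0"
  shows "min_modulus_on p S > 0"
proof -
  have "continuous_on S (\<lambda>z. cmod (poly p z))" by (intro continuous_intros)
  then obtain z where z: "z \<in> S" "\<forall>w\<in>S. cmod (poly p z) \<le> cmod (poly p w)"
    using continuous_attains_inf[OF assms(1,2)] by blast
  then have "cmod (poly p z) \<le> min_modulus_on p S"
    unfolding min_modulus_on_def using assms(2) by (intro cINF_greatest) auto
  then show ?thesis using assms(3)[OF z(1)] by (smt (verit) zero_less_norm_iff)
qed

lemma min_modulus_on_le:
  assumes "z \<in> S"
  shows "min_modulus_on p S \<le> cmod (poly p z)"
  unfolding min_modulus_on_def using assms by (intro cINF_lower) (auto intro!: bdd_belowI[of _ 0])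

lemma compact_closed_annulus: "compact (closed_annulus r R)"
proof -
  have "closed_annulus r R = cball 0 R - ball 0 r"
    by (auto simp: closed_annulus_def)
  then show ?thesis by (simp add: compact_diff)
qed

theorem corollary5p2:
  fixes p p1 p2 :: "complex poly"
    and \<nu> \<kappa> n :: nat
    and r R \<rho> \<delta>\<^sub>0 m1 mK :: real
    and K :: "complex set"
    and c :: "int \<Rightarrow> complex"
  assumes "lead_coeff p = 1" and "degree p = \<nu>" and "\<nu> > 1" and "poly p 0 \<noteq> 0"
    and "0 < r" and "r < 1" and "1 < R"
    and "K = closed_annulus r R"
    and "\<forall>z\<in>K. poly p z \<noteq> 0"
    and "\<kappa> = size {#z \<in># proots p. cmod z < 1#}"
    and "0 < \<kappa>" and "\<kappa> < \<nu>"
    and "p = p1 * p2"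
    and "lead_coeff p1 = 1" and "degree p1 = \<kappa>"
    and "\<forall>z. poly p1 z = 0 \<longrightarrow> cmod z < r"
    and "lead_coeff p2 = 1" and "degree p2 = \<nu> - \<kappa>"
    and "\<forall>z. poly p2 z = 0 \<longrightarrow> cmod z > R"
    and "m1 = min_modulus_on p (sphere 0 1)"
    and "mK = min_modulus_on p K"
    and "\<rho> = max r (1 / R)"
    and "poly_norm p1 * poly_norm p2 \<le> \<delta>\<^sub>0 * poly_norm p"
    and "1 \<le> \<delta>\<^sub>0"
    and "\<delta>\<^sub>0 \<le> exp (2 * catalan_G / pi) ^ \<nu>
               * sqrt ((real \<kappa> + 1) * (real \<nu> - real \<kappa> + 1))"
    and "laurent_coeffs_on (\<lambda>z. 1 / poly p z) K c"
    and "n \<ge> \<nu>"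
  shows "invertible_mat (toeplitz_mat (- int \<kappa>) n c)
       \<and> mat_cond1 (toeplitz_mat (- int \<kappa>) n c)
           \<le> \<delta>\<^sub>0 / mK * ((1 + \<rho>) / (1 - \<rho>)) * poly_norm p
       \<and> mat_cond1 (toeplitz_mat (- int \<kappa>) n c)
           \<le> (2 * real n + 1) * \<delta>\<^sub>0 / m1 * poly_norm p"
proof -
  let ?T = "toeplitz_mat (- int \<kappa>) n c"
  have r: "0 < r" "r < 1" "1 < R" by fact+
  have K: "sphere 0 s \<subseteq> K" if "r \<le> s" "s \<le> R" for s
    using that \<open>K = closed_annulus r R\<close> by (auto simp: closed_annulus_def)
  have K0: "0 \<notin> K" using r \<open>K = closed_annulus r R\<close> by (auto simp: closed_annulus_def)
  have pK: "poly p z \<noteq> 0" if "z \<in> K" for z using that assms(9) by blast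
  note lc = \<open>laurent_coeffs_on (\<lambda>z. 1 / poly p z) K c\<close>
  have "1 \<in> K" using K[of 1] r by auto
  then have mK: "mK > 0"
    using \<open>mK = _\<close> compact_closed_annulus[of r R] \<open>K = closed_annulus r R\<close> pK
    by (auto intro: min_modulus_on_pos)
  have m1: "m1 > 0"
    using \<open>m1 = _\<close> K[of 1] r pK by (auto intro!: min_modulus_on_pos)
  have cK: "cmod (c k) * s powi k \<le> 1 / mK" if "r \<le> s" "s \<le> R" for s k
  proof (rule laurent_coeff_bound[OF lc K[OF that]])
    fix z :: complex assume "cmod z = s"
    then have "mK \<le> cmod (poly p z)"
      using K[OF that] min_modulus_on_le[of z K p] \<open>mK = _\<close> by auto
    then show "cmod (1 / poly p z) \<le> 1 / mK"
      using mK by (simp add: norm_divide frac_le)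
  qed (use that r in auto)
  have c1: "cmod (c k) \<le> 1 / m1" for k
  proof -
    have "cmod (c k) * 1 powi k \<le> 1 / m1"
    proof (rule laurent_coeff_bound[OF lc K])
      fix z :: complex assume "cmod z = 1"
      then have "m1 \<le> cmod (poly p z)"
        using min_modulus_on_le[of z "sphere 0 1" p] \<open>m1 = _\<close> by auto
      then show "cmod (1 / poly p z) \<le> 1 / m1"
        using m1 by (simp add: norm_divide frac_le)
    qed (use r in auto)
    then show ?thesis by simp
  qed
  have \<rho>: "0 \<le> \<rho>" "\<rho> < 1" "r \<le> \<rho>" "1 / R \<le> \<rho>"
    using r \<open>\<rho> = _\<close> by auto
  \<comment> \<open>The estimate on the circle of radius R gives decay R^(-k) for k >= 0, the one on
    radius r gives decay r^|k| for k < 0; \<rho> dominates both rates.\<close>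
  have c\<rho>: "cmod (c k) \<le> 1 / mK * \<rho> ^ nat \<bar>k\<bar>" for k
  proof (cases "k \<ge> 0")
    case True
    then have "cmod (c k) * R ^ nat k \<le> 1 / mK"
      using cK[of R k] r by (simp add: power_int_def)
    then have "cmod (c k) \<le> 1 / mK * (1 / R) ^ nat k"
      using r by (simp add: pos_le_divide_eq power_one_over flip: divide_divide_eq_left)
    also have "\<dots> \<le> 1 / mK * \<rho> ^ nat k"
      using \<rho> r mK by (intro mult_left_mono power_mono) auto
    finally show ?thesis using True by simp
  next
    case False
    then have "cmod (c k) / r ^ nat (-k) \<le> 1 / mK"
      using cK[of r k] r by (simp add: power_int_def field_simps)
    then have "cmod (c k) \<le> 1 / mK * r ^ nat (-k)"
      using r by (simp add: field_simps)
    also have "\<dots> \<le> 1 / mK * \<rho> ^ nat (-k)"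
      using \<rho> r mK by (intro mult_left_mono power_mono) auto
    finally show ?thesis using False by simp
  qed
  \<comment> \<open>By uniqueness, p * (1 / p) = 1 on \<open>K\<close> becomes the statement that
    \<open>p\<close> convolved with \<open>c\<close> is the unit sequence at 0. From here on only
    this recurrence and the boundedness of \<open>c\<close> are used to build the inverse.\<close>
  have "laurent_coeffs_on (\<lambda>z. poly p z * (1 / poly p z)) K (poly_conv p c)"
    using lc K0 by (rule laurent_coeffs_on_poly_conv)
  then have "laurent_coeffs_on (\<lambda>_. 1) K (poly_conv p c)"
    using pK by (simp add: laurent_coeffs_on_def)
  then have "poly_conv p c = (\<lambda>k. of_bool (k = 0))"
    using laurent_coeffs_on_1 by (rule laurent_coeffs_on_unique[of _ K _ _ 1]) (use K r in auto)
  then have conv: "poly_conv (p1 * p2) c k = of_bool (k = 0)" for k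
    using \<open>p = p1 * p2\<close> by simp
  obtain X where X: "X \<in> carrier_mat (n + 1) (n + 1)" "?T * X = 1\<^sub>m (n + 1)"
    "mat_norm1 X \<le> poly_norm p1 * poly_norm p2"
  proof (rule toeplitz_mat_right_inverse[OF conv c1 \<open>degree p1 = \<kappa>\<close>])
    show "p2 \<noteq> 0" using \<open>lead_coeff p2 = 1\<close> by auto
    show "cmod z < 1" if "poly p1 z = 0" for z using that assms(16) r by fastforce
    show "cmod z > 1" if "poly p2 z = 0" for z using that assms(19) r by fastforce
    show "degree p1 + degree p2 \<le> n" using assms by simp
  qed (use assms in auto)
  note cond = mat_cond1_eq[OF toeplitz_mat_carrier X(1,2)]
  have bound: "mat_cond1 ?T \<le> B * (\<delta>\<^sub>0 * poly_norm p)" if "mat_norm1 ?T \<le> B" for B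
    unfolding cond(2)
    using that X(3) assms(23) mat_norm1_nonneg[OF X(1)] mat_norm1_nonneg[OF toeplitz_mat_carrier, of n "- int \<kappa>" c]
    by (intro mult_mono) auto
  have "(\<Sum>k\<in>F. cmod (c k)) \<le> 1 / mK * ((1 + \<rho>) / (1 - \<rho>))" if "finite F" for F
  proof -
    have "(\<Sum>k\<in>F. cmod (c k)) \<le> 1 / mK * (\<Sum>k\<in>F. \<rho> ^ nat \<bar>k\<bar>)"
      unfolding sum_distrib_left by (intro sum_mono c\<rho>)
    also have "\<dots> \<le> 1 / mK * ((1 + \<rho>) / (1 - \<rho>))"
      using mK \<rho> that by (intro mult_left_mono sum_power_abs_le) auto
    finally show ?thesis .
  qed
  then have 1: "mat_cond1 ?T \<le> 1 / mK * ((1 + \<rho>) / (1 - \<rho>)) * (\<delta>\<^sub>0 * poly_norm p)"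
    by (intro bound toeplitz_mat_norm_le)
  \<comment> \<open>A column has n + 1 entries, each at most 1 / m1; 2n + 1 is the number of
    diagonals and is at least n + 1.\<close>
  have "(\<Sum>k\<in>F. cmod (c k)) \<le> (2 * real n + 1) / m1" if "card F = n + 1" for F
  proof -
    have "(\<Sum>k\<in>F. cmod (c k)) \<le> real (n + 1) * (1 / m1)"
      using sum_bounded_above[of F "\<lambda>k. cmod (c k)" "1 / m1"] c1 that by simp
    also have "\<dots> \<le> (2 * real n + 1) / m1"
      using m1 by (simp add: divide_right_mono)
    finally show ?thesis .
  qed
  then have 2: "mat_cond1 ?T \<le> (2 * real n + 1) / m1 * (\<delta>\<^sub>0 * poly_norm p)"
    by (intro bound toeplitz_mat_norm_le)
  show ?thesis
    using cond(1) 1 2 by (simp add: mult.commute mult.left_commute)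
qed

end
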